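(* There is no $2$-connected nontrivial uniquely $C_9$-saturated graph $G$ whose longest even cycle of length at most $12$ has length $10$; that is, no $2$-connected nontrivial uniquely $C_9$-saturated graph contains a cycle of length $10$ and no cycle of length $12$.
   Context: All graphs are finite and simple. A graph $G$ is uniquely $C_9$-saturated if it contains no cycle of length $9$ and, for every edge $e$ of the complement $\overline{G}$, $G+e$ contains exactly one cycle of length $9$; it is nontrivial if $|V(G)|\ge 9$. "Longest even cycle of length at most $12$" means a longest cycle among all even cycles of $G$ whose length is at most $12$. *)

theory Defs
  imports Main
begin

text \<open>
  A graph is given by a vertex set \<open>V\<close> and a set \<open>E\<close> of two-element subsets of \<open>V\<close>.
\<close>

definition all_edges :: "'a set \<Rightarrow> 'a set set" where
  "all_edges V = {e. e \<subseteq> V \<and> card e = 2}"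

definition fin_simple_graph :: "'a set \<Rightarrow> 'a set set \<Rightarrow> bool" where
  "fin_simple_graph V E \<longleftrightarrow> finite V \<and> E \<subseteq> all_edges V"

text \<open>
  A cycle is a subgraph, not a closed walk: rotations and reversals of the vertex sequence
  must not be counted separately. It is represented by its edge set, which determines the
  subgraph because a cycle has no isolated vertices.
\<close>

definition cycle_edges :: "'a list \<Rightarrow> 'a set set" where
  "cycle_edges vs = {{vs ! i, vs ! (Suc i mod length vs)} | i. i < length vs}"

definition is_cycle :: "nat \<Rightarrow> 'a set set \<Rightarrow> 'a set set \<Rightarrow> bool" where
  "is_cycle k E C \<longleftrightarrow> k \<ge> 3 \<and> C \<subseteq> E \<and>
     (\<exists>vs. distinct vs \<and> length vs = k \<and> C = cycle_edges vs)"

definition has_cycle :: "nat \<Rightarrow> 'a set set \<Rightarrow> bool" where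
  "has_cycle k E \<longleftrightarrow> (\<exists>C. is_cycle k E C)"

definition uniquely_cycle_saturated :: "nat \<Rightarrow> 'a set \<Rightarrow> 'a set set \<Rightarrow> bool" where
  "uniquely_cycle_saturated k V E \<longleftrightarrow> \<not> has_cycle k E \<and>
     (\<forall>e \<in> all_edges V - E. \<exists>!C. is_cycle k (insert e E) C)"

definition connected_graph :: "'a set \<Rightarrow> 'a set set \<Rightarrow> bool" where
  "connected_graph V E \<longleftrightarrow> V \<noteq> {} \<and>
     (\<forall>u \<in> V. \<forall>v \<in> V. (u, v) \<in> {(x, y). {x, y} \<in> E}\<^sup>*)"

definition k_connected :: "nat \<Rightarrow> 'a set \<Rightarrow> 'a set set \<Rightarrow> bool" where
  "k_connected k V E \<longleftrightarrow> card V > k \<and>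
     (\<forall>X \<subseteq> V. card X < k \<longrightarrow> connected_graph (V - X) {e \<in> E. e \<inter> X = {}})"

text \<open>The longest even cycle of length at most \<open>b\<close> exists and has length \<open>l\<close>.\<close>

definition longest_even_cycle_at_most :: "nat \<Rightarrow> 'a set set \<Rightarrow> nat \<Rightarrow> bool" where
  "longest_even_cycle_at_most b E l \<longleftrightarrow>
     even l \<and> l \<le> b \<and> has_cycle l E \<and>
     (\<forall>m. even m \<and> m \<le> b \<and> has_cycle m E \<longrightarrow> m \<le> l)"

end

theory Submission imports Defs begin

text \<open>
  Saturation says that two distinct vertices are joined by a path on nine vertices exactly when
  they are not adjacent, and that such a path is then unique. Both halves are used against a cycle
  \<open>v 0, \<dots>, v 9\<close> of length ten, called a decagon below.

  Uniqueness makes the graph sparse around the decagon. For instance, two ways round the decagon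
  from \<open>v 0\<close> to \<open>v 5\<close>, each extended by the same path with three further edges leaving the decagon
  at \<open>v 0\<close>, are two paths on nine vertices with the same ends; so no such path leaves the decagon,
  and with 2-connectedness every vertex off the decagon has all its neighbours on it, at least two
  of them (\<open>outside_touches_decagon\<close>, \<open>outside_independent\<close>, \<open>outside_feet\<close>). Similar detours show
  that a chord of the decagon spans 4 or 5 of its edges, and that two neighbours of an outside
  vertex are consecutive or antipodal. Call a chord, or an outside vertex with its two edges (a
  hat), an ear. Any two ears produce a cycle of length 9 or 12 or two paths on nine vertices with
  the same ends, all of which are excluded; the only exception is a hat over a chord of gap 5.

  Hence every edge belongs to one of three graphs: the decagon with a chord of gap 4, the decagon
  with a hat over an edge, or the decagon with a hat over a chord of gap 5. In each of them \<open>v 0\<close>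
  and \<open>v 3\<close> are neither adjacent nor joined by a path on nine vertices, so existence fails
  (\<open>sparse_impossible\<close>).

  The forced cycles and pairs of paths are listed explicitly over a decagon labelled by
  \<open>0, \<dots>, 9\<close>; a labelled list is checked by rewriting and then transported to the graph
  (\<open>clash_impossible\<close>).
\<close>

section \<open>Labelled configurations and the clashes that refute them\<close>

text \<open>
  A contradiction, in labels: a 9-cycle or two different paths on nine vertices with the same ends,
  which saturation forbids, or a 12-cycle.
\<close>

datatype clash = Cycle "nat list" | Twin "nat list" "nat list"

definition linked :: "(nat \<times> nat) list \<Rightarrow> nat \<Rightarrow> nat \<Rightarrow> bool" where
  "linked L i j \<longleftrightarrow> (i, j) \<in> set L \<or> (j, i) \<in> set L"

fun refutes :: "(nat \<times> nat) list \<Rightarrow> clash \<Rightarrow> bool" where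
  "refutes L (Cycle p) \<longleftrightarrow>
     (length p = 9 \<or> length p = 12) \<and> distinct p \<and>
     successively (linked L) p \<and> linked L (last p) (hd p)"
| "refutes L (Twin p q) \<longleftrightarrow>
     length p = 9 \<and> length q = 9 \<and> distinct p \<and> distinct q \<and>
     successively (linked L) p \<and> successively (linked L) q \<and>
     hd p = hd q \<and> last p = last q \<and> p \<noteq> q"

definition decagon :: "(nat \<times> nat) list" where
  "decagon = [(0,1),(1,2),(2,3),(3,4),(4,5),(5,6),(6,7),(7,8),(8,9),(9,0)]"

lemma decagon_ring:
  assumes "i < 10"
  shows "linked decagon i ((i + 1) mod 10)"
proof -
  have "\<forall>i\<in>set [0..<10]. linked decagon i ((i + 1) mod 10)" by code_simp
  moreover have "i \<in> set [0..<10]" using assms by simp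
  ultimately show ?thesis by blast
qed

text \<open>
  The reflection of the decagon that exchanges \<open>0\<close> and \<open>c\<close>. When one ear joins \<open>0\<close> to \<open>c\<close>, this
  reflection preserves it, so only one of two mirror-image positions of a second ear needs an
  entry in a table of clashes. Labels from 10 on name vertices off the decagon and stay fixed.
\<close>

definition mirror :: "nat \<Rightarrow> nat \<Rightarrow> nat" where
  "mirror c i = (if i < 10 then (c + 10 - i) mod 10 else i)"

fun mirror_clash :: "nat \<Rightarrow> clash \<Rightarrow> clash" where
  "mirror_clash c (Cycle p) = Cycle (map (mirror c) p)"
| "mirror_clash c (Twin p q) = Twin (map (mirror c) p) (map (mirror c) q)"

text \<open>
  A mirrored entry is verified against the given edges like any other, and this alone makes a table
  sound.
\<close>

definition clashing :: "nat \<Rightarrow> clash list \<Rightarrow> (nat \<times> nat) list \<Rightarrow> bool" where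
  "clashing c T L \<longleftrightarrow> list_ex (\<lambda>w. refutes L w \<or> refutes L (mirror_clash c w)) T"

lemma successively_linked_bounded:
  assumes "successively (linked L) p" "2 \<le> length p"
    and "\<And>i j. (i, j) \<in> set L \<Longrightarrow> i < n \<and> j < n"
  shows "set p \<subseteq> {..<n}"
  using assms(1,2)
proof (induction p rule: induct_list012)
  case (3 x y zs)
  then have "x < n" "y < n" using assms(3) by (auto simp: linked_def)
  with 3 show ?case by (cases zs) auto
qed auto

section \<open>Searching for paths of a given length\<close>

text \<open>
  Depth-first search: \<open>route L k S a b\<close> asks for a path with \<open>k\<close> edges from \<open>a\<close> to \<open>b\<close> whose later
  vertices avoid the set \<open>S\<close> of vertices already visited.
\<close>

fun route :: "(nat \<times> nat) list \<Rightarrow> nat \<Rightarrow> nat list \<Rightarrow> nat \<Rightarrow> nat \<Rightarrow> bool" where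
  "route L 0 S a b \<longleftrightarrow> a = b"
| "route L (Suc k) S a b \<longleftrightarrow>
     list_ex (\<lambda>(x, y). x = a \<and> y \<notin> set S \<and> route L k (y # S) y b \<or>
                      y = a \<and> x \<notin> set S \<and> route L k (x # S) x b) L"

lemma route_complete:
  assumes "distinct p" "length p = Suc k" "successively (linked L) p"
    and "hd p = a" "last p = b" "set (tl p) \<inter> set S = {}" "a \<in> set S"
  shows "route L k S a b"
  using assms
proof (induction k arbitrary: p S a)
  case 0
  then show ?case by (cases p) auto
next
  case (Suc k)
  then obtain y r where p: "p = a # y # r"
    by (cases p; cases "tl p") auto
  have "route L k (y # S) y b"
    using Suc.prems p by (intro Suc.IH[of "y # r"]) auto
  moreover have "linked L a y" "y \<notin> set S" using Suc.prems p by auto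
  ultimately show ?case by (auto simp: linked_def list_ex_iff)
qed

section \<open>The finite checks\<close>

text \<open>
  In the tables, one ear is placed at \<open>0\<close>, its apex, if it has one, being \<open>10\<close>. The apex of a
  second hat is \<open>11\<close>, except next to the chord from \<open>0\<close> to \<open>4\<close>, where it is \<open>10\<close>. A bridge is a
  path with three edges that leaves the decagon at \<open>0\<close> and returns through \<open>10\<close> and \<open>11\<close>.
\<close>

definition chord_clashes :: "clash list" where
  "chord_clashes =
   [Cycle [0,9,8,7,6,5,4,3,2],
    Twin [1,0,3,4,5,6,7,8,9] [1,2,3,4,5,6,7,8,9]]"

definition hat_clashes :: "clash list" where
  "hat_clashes =
   [Twin [0,1,2,3,4,5,6,7,8] [0,10,2,3,4,5,6,7,8],
    Cycle [0,9,8,7,6,5,4,3,10],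
    Twin [1,0,10,4,5,6,7,8,9] [1,2,3,4,5,6,7,8,9]]"

definition bridge_clashes :: "clash list" where
  "bridge_clashes =
   [Twin [4,5,6,7,8,9,0,1,11] [4,5,6,7,8,9,0,10,11],
    Twin [1,0,10,11,2,3,4,5,6] [1,2,11,10,0,9,8,7,6],
    Twin [0,1,2,3,4,5,6,7,8] [0,10,11,3,4,5,6,7,8],
    Cycle [0,9,8,7,6,5,4,11,10],
    Twin [1,0,10,11,5,6,7,8,9] [1,2,3,4,5,6,7,8,9]]"

definition gap4_clashes :: "clash list" where
  "gap4_clashes =
   [Twin [0,1,2,3,4,5,6,7,8] [0,4,3,2,1,5,6,7,8],
    Twin [1,0,9,8,7,6,5,4,3] [1,2,6,7,8,9,0,4,3],
    Twin [1,0,9,8,7,3,4,5,6] [1,2,3,4,0,9,8,7,6],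
    Twin [3,2,1,0,9,8,7,6,5] [3,2,1,0,4,8,7,6,5],
    Twin [1,2,3,4,5,9,8,7,6] [1,2,3,4,0,9,8,7,6],
    Twin [2,1,0,4,5,6,7,8,9] [2,3,4,0,5,6,7,8,9],
    Cycle [0,9,8,7,6,1,2,3,4],
    Twin [1,2,3,4,0,9,8,7,6] [1,2,7,8,9,0,4,5,6],
    Twin [1,2,3,4,5,6,7,8,9] [1,10,0,4,5,6,7,8,9],
    Twin [2,3,4,0,9,8,7,6,5] [2,10,1,0,9,8,7,6,5],
    Twin [1,0,4,10,5,6,7,8,9] [1,2,3,4,5,6,7,8,9],
    Twin [1,0,4,5,10,6,7,8,9] [1,2,3,4,5,6,7,8,9],
    Twin [1,0,4,5,6,10,7,8,9] [1,2,3,4,5,6,7,8,9],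
    Twin [2,1,0,4,5,6,7,8,9] [2,1,0,10,5,6,7,8,9],
    Twin [0,1,2,3,4,5,6,7,8] [0,4,3,2,1,10,6,7,8],
    Twin [1,0,9,8,7,6,5,4,3] [1,0,4,5,6,7,10,2,3]]"

definition short_hat_clashes :: "clash list" where
  "short_hat_clashes =
   [Twin [8,7,6,5,4,3,2,1,10] [8,9,0,5,4,3,2,1,10],
    Twin [4,3,2,7,8,9,0,1,10] [4,5,6,7,8,9,0,1,10],
    Twin [6,5,4,3,2,1,10,0,9] [6,7,8,3,2,1,10,0,9],
    Twin [0,10,1,2,3,4,5,6,7] [0,11,1,2,3,4,5,6,7],
    Cycle [0,9,8,7,6,5,4,3,2,11,1,10],
    Cycle [0,9,8,7,6,5,4,3,11,2,1,10],
    Cycle [0,9,8,7,6,5,4,11,3,2,1,10],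
    Cycle [0,9,8,7,6,5,11,4,3,2,1,10],
    Cycle [0,9,8,7,6,11,5,4,3,2,1,10],
    Twin [1,2,3,4,5,6,7,8,9] [1,10,0,11,5,6,7,8,9],
    Twin [3,4,5,6,7,8,9,0,10] [3,4,5,6,7,11,2,1,10],
    Twin [0,9,8,11,3,4,5,6,7] [0,10,1,2,3,4,5,6,7]]"

definition long_hat_clashes :: "clash list" where
  "long_hat_clashes =
   [Twin [2,1,6,5,10,0,9,8,7] [2,3,4,5,10,0,9,8,7],
    Cycle [0,9,8,7,2,3,4,5,10],
    Twin [1,2,3,4,5,10,0,9,8] [1,2,3,4,5,11,0,9,8],
    Cycle [0,9,8,7,6,11,1,2,3,4,5,10],
    Twin [0,1,2,3,4,5,6,7,8] [0,10,5,4,3,2,11,7,8]]"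

definition diameter_clashes :: "clash list" where
  "diameter_clashes =
   [Twin [0,1,2,3,4,5,6,7,8] [0,5,4,3,2,1,6,7,8],
    Twin [1,0,9,8,7,6,5,4,3] [1,2,7,8,9,0,5,4,3]]"

text \<open>
  Each table covers all positions of the ear in question up to the reflection. The gap between two
  labels is the number of steps from the first to the second, so the gaps \<open>d\<close> and \<open>10 - d\<close> describe
  the same distance.
\<close>

lemma check_chord:
  assumes "d < 10" "d \<notin> {0,1,4,5,6,9}"
  shows "clashing 0 chord_clashes ([(0,d)] @ decagon)"
proof -
  have "\<forall>d\<in>set [2,3,7,8]. clashing 0 chord_clashes ([(0,d)] @ decagon)"
    by code_simp
  moreover have "d \<in> set [2,3,7,8]" using assms by auto
  ultimately show ?thesis by blast
qed

lemma check_hat: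
  assumes "d < 10" "d \<notin> {0,1,5,9}"
  shows "clashing 0 hat_clashes ([(0,10),(10,d)] @ decagon)"
proof -
  have "\<forall>d\<in>set [2,3,4,6,7,8]. clashing 0 hat_clashes ([(0,10),(10,d)] @ decagon)"
    by code_simp
  moreover have "d \<in> set [2,3,4,6,7,8]" using assms by auto
  ultimately show ?thesis by blast
qed

lemma check_bridge:
  assumes "d < 10" "d \<noteq> 0"
  shows "clashing 0 bridge_clashes ([(0,10),(10,11),(11,d)] @ decagon)"
proof -
  have "\<forall>d\<in>set [1..<10]. clashing 0 bridge_clashes ([(0,10),(10,11),(11,d)] @ decagon)"
    by code_simp
  moreover have "d \<in> set [1..<10]" using assms by simp
  ultimately show ?thesis by blast
qed

text \<open>
  The two ways round the decagon from \<open>0\<close> to \<open>5\<close>, both extended by the tail.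
\<close>

lemma check_tail:
  "clashing 0 [Twin [12,11,10,0,1,2,3,4,5] [12,11,10,0,9,8,7,6,5]]
     ([(0,10),(10,11),(11,12)] @ decagon)"
  by code_simp

lemma check_gap4_chord:
  assumes "i < 10" "d \<in> {4,5,6}" "(i, (i + d) mod 10) \<notin> {(0,4),(4,0)}"
  shows "clashing 4 gap4_clashes ([(0,4),(i,(i + d) mod 10)] @ decagon)"
proof -
  have "\<forall>i\<in>set [0..<10]. \<forall>d\<in>set [4,5,6]. (i, (i + d) mod 10) \<in> {(0,4),(4,0)} \<or>
      clashing 4 gap4_clashes ([(0,4),(i,(i + d) mod 10)] @ decagon)"
    by code_simp
  moreover have "i \<in> set [0..<10]" "d \<in> set [4,5,6]" using assms by simp_all
  ultimately show ?thesis using assms(3) by blast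
qed

lemma check_gap4_hat:
  assumes "i < 10" "d \<in> {1,5,9}"
  shows "clashing 4 gap4_clashes ([(0,4),(i,10),(10,(i + d) mod 10)] @ decagon)"
proof -
  have "\<forall>i\<in>set [0..<10]. \<forall>d\<in>set [1,5,9].
      clashing 4 gap4_clashes ([(0,4),(i,10),(10,(i + d) mod 10)] @ decagon)"
    by code_simp
  moreover have "i \<in> set [0..<10]" "d \<in> set [1,5,9]" using assms by simp_all
  ultimately show ?thesis by blast
qed

lemma check_short_hat_chord:
  assumes "i < 10"
  shows "clashing 1 short_hat_clashes ([(0,10),(10,1),(i,(i + 5) mod 10)] @ decagon)"
proof -
  have "\<forall>i\<in>set [0..<10].
      clashing 1 short_hat_clashes ([(0,10),(10,1),(i,(i + 5) mod 10)] @ decagon)"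
    by code_simp
  moreover have "i \<in> set [0..<10]" using assms by simp
  ultimately show ?thesis by blast
qed

lemma check_short_hat_hat:
  assumes "i < 10" "d \<in> {1,5,9}"
  shows "clashing 1 short_hat_clashes ([(0,10),(10,1),(i,11),(11,(i + d) mod 10)] @ decagon)"
proof -
  have "\<forall>i\<in>set [0..<10]. \<forall>d\<in>set [1,5,9]. clashing 1 short_hat_clashes
      ([(0,10),(10,1),(i,11),(11,(i + d) mod 10)] @ decagon)"
    by code_simp
  moreover have "i \<in> set [0..<10]" "d \<in> set [1,5,9]" using assms by simp_all
  ultimately show ?thesis by blast
qed

lemma check_long_hat_chord:
  assumes "i < 10" "i \<noteq> 0" "i \<noteq> 5"
  shows "clashing 5 long_hat_clashes ([(0,10),(10,5),(i,(i + 5) mod 10)] @ decagon)"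
proof -
  have "\<forall>i\<in>set [1,2,3,4,6,7,8,9]. clashing 5 long_hat_clashes
      ([(0,10),(10,5),(i,(i + 5) mod 10)] @ decagon)"
    by code_simp
  moreover have "i \<in> set [1,2,3,4,6,7,8,9]" using assms by auto
  ultimately show ?thesis by blast
qed

lemma check_long_hat_hat:
  assumes "i < 10"
  shows "clashing 5 long_hat_clashes ([(0,10),(10,5),(i,11),(11,(i + 5) mod 10)] @ decagon)"
proof -
  have "\<forall>i\<in>set [0..<10]. clashing 5 long_hat_clashes
      ([(0,10),(10,5),(i,11),(11,(i + 5) mod 10)] @ decagon)"
    by code_simp
  moreover have "i \<in> set [0..<10]" using assms by simp
  ultimately show ?thesis by blast
qed

lemma check_diameter_chord:
  assumes "i < 10" "i \<noteq> 0" "i \<noteq> 5"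
  shows "clashing 5 diameter_clashes ([(0,5),(i,(i + 5) mod 10)] @ decagon)"
proof -
  have "\<forall>i\<in>set [1,2,3,4,6,7,8,9]. clashing 5 diameter_clashes
      ([(0,5),(i,(i + 5) mod 10)] @ decagon)"
    by code_simp
  moreover have "i \<in> set [1,2,3,4,6,7,8,9]" using assms by auto
  ultimately show ?thesis by blast
qed

text \<open>
  A single pair of vertices, \<open>0\<close> and \<open>3\<close>, refutes saturation in all three remaining graphs.
\<close>

lemma check_sparse:
  assumes "X \<in> {[(0,4)], [(0,10),(10,1)], [(0,5),(0,10),(10,5)]}"
  shows "\<not> route (X @ decagon) 8 [0] 0 3" "\<not> linked (X @ decagon) 0 3"
proof -
  have "list_all (\<lambda>X. \<not> route (X @ decagon) 8 [0] 0 3 \<and> \<not> linked (X @ decagon) 0 3)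
      [[(0,4)], [(0,10),(10,1)], [(0,5),(0,10),(10,5)]]"
    by code_simp
  then show "\<not> route (X @ decagon) 8 [0] 0 3" "\<not> linked (X @ decagon) 0 3"
    using assms by auto
qed

section \<open>Saturation as a statement about paths on nine vertices\<close>

text \<open>
  The consequences of unique \<open>C\<^sub>9\<close>-saturation, the absence of 12-cycles and 2-connectedness on which
  the argument rests. Paths are given by their vertex lists, so that the edge of the complement
  that closes a cycle disappears from view, and 2-connectedness is used as the existence of an edge
  across every cut of the graph minus at most one vertex.
\<close>

locale path_saturated =
  fixes V :: "'a set" and adj :: "'a \<Rightarrow> 'a \<Rightarrow> bool"
  assumes finite_V: "finite V"
    and adj_in: "adj x y \<Longrightarrow> x \<in> V \<and> y \<in> V"
    and adj_sym: "adj x y \<Longrightarrow> adj y x"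
    and adj_irrefl: "\<not> adj x x"
    and no_cycle: "length p = 9 \<or> length p = 12 \<Longrightarrow> distinct p \<Longrightarrow> successively adj p
        \<Longrightarrow> \<not> adj (last p) (hd p)"
    and path_unique: "length p = 9 \<Longrightarrow> length q = 9 \<Longrightarrow> distinct p \<Longrightarrow> distinct q
        \<Longrightarrow> successively adj p \<Longrightarrow> successively adj q
        \<Longrightarrow> hd p = hd q \<Longrightarrow> last p = last q \<Longrightarrow> p = q"
    and path_exists: "x \<in> V \<Longrightarrow> y \<in> V \<Longrightarrow> x \<noteq> y \<Longrightarrow> \<not> adj x y
        \<Longrightarrow> \<exists>p. length p = 9 \<and> distinct p \<and> successively adj p \<and> hd p = x \<and> last p = y"
    and crossing: "X \<subseteq> V \<Longrightarrow> card X < 2 \<Longrightarrow> S \<subseteq> V - X \<Longrightarrow> S \<noteq> {} \<Longrightarrow> S \<noteq> V - X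
        \<Longrightarrow> \<exists>x\<in>S. \<exists>y\<in>V - X - S. adj x y"
begin

definition decagon_at :: "(nat \<Rightarrow> 'a) \<Rightarrow> bool" where
  "decagon_at v \<longleftrightarrow> inj_on v {..<10} \<and> (\<forall>i<10. adj (v i) (v ((i + 1) mod 10)))"

text \<open>
  An injective labelling carries a cycle or a pair of paths from the labels into the graph, where
  it contradicts \<open>no_cycle\<close> or \<open>path_unique\<close>.
\<close>

lemma clash_impossible:
  assumes inj: "inj_on f {..<n}"
    and L: "\<And>i j. (i, j) \<in> set L \<Longrightarrow> i < n \<and> j < n \<and> adj (f i) (f j)"
    and "clashing c T L"
  shows False
proof -
  have transfer: "distinct (map f p) \<and> successively adj (map f p)"
    if "distinct p" "successively (linked L) p" "2 \<le> length p" for p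
  proof -
    have "set p \<subseteq> {..<n}" using successively_linked_bounded[OF that(2,3)] L by blast
    then have "inj_on f (set p)" using inj by (rule inj_on_subset[rotated])
    moreover have "successively (\<lambda>i j. adj (f i) (f j)) p"
      using that(2) by (rule successively_mono) (auto simp: linked_def dest: L adj_sym)
    ultimately show ?thesis using that by (simp add: distinct_map successively_map)
  qed
  have no_refutation: "\<not> refutes L w" for w
  proof (cases w)
    case (Cycle p)
    show ?thesis
    proof
      assume r: "refutes L w"
      then have "adj (f (last p)) (f (hd p))"
        using Cycle by (auto simp: linked_def dest: L adj_sym)
      moreover have "p \<noteq> []" using r Cycle by auto
      ultimately have "adj (last (map f p)) (hd (map f p))"
        by (simp add: last_map hd_map)
      moreover have "distinct (map f p) \<and> successively adj (map f p)"
        using r Cycle by (intro transfer) auto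
      ultimately show False using no_cycle[of "map f p"] r Cycle by auto
    qed
  next
    case (Twin p q)
    show ?thesis
    proof
      assume r: "refutes L w"
      have ne: "p \<noteq> []" "q \<noteq> []" using r Twin by auto
      have "distinct (map f p) \<and> successively adj (map f p)"
        "distinct (map f q) \<and> successively adj (map f q)"
        using r Twin by (auto intro!: transfer[THEN conjunct1] transfer[THEN conjunct2])
      then have "map f p = map f q"
        using r Twin ne by (intro path_unique) (auto simp: last_map hd_map)
      moreover have "set p \<union> set q \<subseteq> {..<n}"
        using r Twin successively_linked_bounded[of L p n] successively_linked_bounded[of L q n] L
        by auto
      ultimately have "p = q" using inj by (metis inj_on_map_eq_map inj_on_subset)
      then show False using r Twin by simp
    qed
  qed
  show False using assms(3) no_refutation by (auto simp: clashing_def list_ex_iff)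
qed

lemma decagon_edge:
  assumes "decagon_at v" "(i, j) \<in> set decagon"
  shows "i < 10 \<and> j < 10 \<and> adj (v i) (v j)"
proof -
  have "j = (i + 1) mod 10" "i < 10" using assms(2) by (auto simp: decagon_def)
  then show ?thesis using assms(1) by (auto simp: decagon_at_def)
qed

lemma decagon_clash:
  assumes "decagon_at v" "inj_on f {..<n}" "10 \<le> n" "\<And>i. i < 10 \<Longrightarrow> f i = v i"
    and "\<And>i j. (i, j) \<in> set X \<Longrightarrow> i < n \<and> j < n \<and> adj (f i) (f j)"
    and "clashing c T (X @ decagon)"
  shows False
proof (rule clash_impossible[OF assms(2) _ assms(6)])
  fix i j assume "(i, j) \<in> set (X @ decagon)"
  then show "i < n \<and> j < n \<and> adj (f i) (f j)"
    using decagon_edge[OF assms(1), of i j] assms(3,4,5) by auto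
qed

text \<open>
  Labels are attached one by one to vertices off the decagon, always using the next free number.
\<close>

lemma inj_on_extend:
  assumes "inj_on f {..<n}" "x \<notin> f ` {..<n}" "m = Suc n"
  shows "inj_on (f(n := x)) {..<m}" "(f(n := x)) ` {..<m} = insert x (f ` {..<n})"
  using assms by (auto simp: inj_on_def less_Suc_eq lessThan_Suc image_iff)

lemma one_apex:
  assumes "decagon_at v" "x \<notin> v ` {..<10}"
  shows "inj_on (v(10 := x)) {..<11}" "(v(10 := x)) ` {..<11} = insert x (v ` {..<10})"
  using inj_on_extend[of v 10 x 11] assms unfolding decagon_at_def by simp_all

lemma two_apexes:
  assumes "decagon_at v" "x \<notin> v ` {..<10}" "y \<notin> v ` {..<10}" "x \<noteq> y"
  shows "inj_on (v(10 := x, 11 := y)) {..<12}"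
    "(v(10 := x, 11 := y)) ` {..<12} = insert y (insert x (v ` {..<10}))"
proof -
  have "y \<notin> (v(10 := x)) ` {..<11}"
    by (simp only: one_apex(2)[OF assms(1,2)] insert_iff) (use assms(3,4) in auto)
  from inj_on_extend[OF one_apex(1)[OF assms(1,2)] this, of 12]
  show "inj_on (v(10 := x, 11 := y)) {..<12}"
    "(v(10 := x, 11 := y)) ` {..<12} = insert y (insert x (v ` {..<10}))"
    using one_apex(2)[OF assms(1,2)] by simp_all
qed

lemma three_apexes:
  assumes "decagon_at v" "x \<notin> v ` {..<10}" "y \<notin> v ` {..<10}" "z \<notin> v ` {..<10}"
    and "x \<noteq> y" "x \<noteq> z" "y \<noteq> z"
  shows "inj_on (v(10 := x, 11 := y, 12 := z)) {..<13}"
proof -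
  have "z \<notin> (v(10 := x, 11 := y)) ` {..<12}"
    by (simp only: two_apexes(2)[OF assms(1,2,3,5)] insert_iff) (use assms(4,6,7) in auto)
  from inj_on_extend(1)[OF two_apexes(1)[OF assms(1,2,3,5)] this, of 13]
  show ?thesis by simp
qed

text \<open>
  These bounds discharge the label conditions of the clash rules; they also distinguish a position
  on the decagon, computed modulo 10, from the labels 10 and 11 of the apexes.
\<close>

lemma residue_bounds [simp]:
  fixes k :: nat
  shows "k mod 10 < 10" "k mod 10 < 11" "k mod 10 < 12" "k mod 10 \<noteq> 10" "k mod 10 \<noteq> 11"
proof -
  show "k mod 10 < 10" by simp
  then show "k mod 10 < 11" "k mod 10 < 12" "k mod 10 \<noteq> 10" "k mod 10 \<noteq> 11" by linarith+
qed

lemma decagon_clash0: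
  assumes "decagon_at v" "clashing c T (X @ decagon)"
    and "\<forall>(i, j)\<in>set X. i < 10 \<and> j < 10 \<and> adj (v i) (v j)"
  shows False
  by (rule decagon_clash[OF assms(1) _ _ _ _ assms(2), of v 10])
    (use assms in \<open>auto simp: decagon_at_def\<close>)

lemma decagon_clash1:
  assumes "decagon_at v" "x \<notin> v ` {..<10}" "clashing c T (X @ decagon)"
    and "\<forall>(i, j)\<in>set X. i < 11 \<and> j < 11 \<and> adj ((v(10 := x)) i) ((v(10 := x)) j)"
  shows False
  by (rule decagon_clash[OF assms(1) one_apex(1)[OF assms(1,2)] _ _ _ assms(3)])
    (use assms(4) in auto)

lemma decagon_clash2:
  assumes "decagon_at v" "x \<notin> v ` {..<10}" "y \<notin> v ` {..<10}" "x \<noteq> y"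
    and "clashing c T (X @ decagon)"
    and "\<forall>(i, j)\<in>set X. i < 12 \<and> j < 12 \<and>
      adj ((v(10 := x, 11 := y)) i) ((v(10 := x, 11 := y)) j)"
  shows False
  by (rule decagon_clash[OF assms(1) two_apexes(1)[OF assms(1-4)] _ _ _ assms(5)])
    (use assms(6) in auto)

text \<open>
  Turning the decagon moves any chosen ear to position \<open>0\<close>, where the tables apply.
\<close>

abbreviation (input) turn :: "nat \<Rightarrow> (nat \<Rightarrow> 'a) \<Rightarrow> nat \<Rightarrow> 'a" where
  "turn k v \<equiv> (\<lambda>i. v ((i + k) mod 10))"

lemma shift_image: "(\<lambda>i. (i + k) mod 10) ` {..<10} = {..<10::nat}"
proof -
  have "i \<in> (\<lambda>i. (i + k) mod 10) ` {..<10}" if "i < 10" for i :: nat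
  proof
    have "((i + 9 * k) mod 10 + k) mod 10 = (i + 10 * k) mod 10"
      by (simp add: mod_simps)
    then show "i = ((i + 9 * k) mod 10 + k) mod 10" using that by simp
  qed simp
  then show ?thesis by auto
qed

lemma decagon_at_turn:
  assumes "decagon_at v"
  shows "decagon_at (turn k v)"
proof -
  have "inj_on (\<lambda>i. (i + k) mod 10) {..<10::nat}"
    by (rule eq_card_imp_inj_on) (simp_all add: shift_image)
  then have "inj_on (turn k v) {..<10}"
    using comp_inj_on[of "\<lambda>i. (i + k) mod 10" "{..<10}" v] assms
    by (simp add: shift_image decagon_at_def comp_def)
  moreover have "adj (turn k v i) (turn k v ((i + 1) mod 10))" for i
  proof -
    have "adj (v ((i + k) mod 10)) (v (((i + k) mod 10 + 1) mod 10))"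
      using assms by (simp add: decagon_at_def)
    moreover have "((i + k) mod 10 + 1) mod 10 = ((i + 1) mod 10 + k) mod 10"
      by (simp add: mod_simps)
    ultimately show ?thesis by simp
  qed
  ultimately show ?thesis by (simp add: decagon_at_def)
qed

lemma turn_image: "turn k v ` {..<10} = v ` {..<10}"
proof -
  have "turn k v ` {..<10} = v ` (\<lambda>i. (i + k) mod 10) ` {..<10}"
    by (rule image_image[symmetric])
  then show ?thesis by (simp only: shift_image)
qed

section \<open>Chords of a decagon and the vertices around it\<close>

lemma turn_outside: "x \<notin> v ` {..<10} \<Longrightarrow> x \<notin> turn k v ` {..<10}"
  unfolding turn_image .

text \<open>
  Besides the edges of the decagon (gaps 1 and 9), chords of gap 4 or 5 remain: a chord of gap 2
  cuts off a 9-cycle, and a chord of gap 3 offers two ways through a 4-cycle inside a path on nine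
  vertices.
\<close>

lemma chord_gap:
  assumes v: "decagon_at v" and "d < 10" "i < 10" "adj (v i) (v ((i + d) mod 10))"
  shows "d \<in> {1,4,5,6,9}"
proof (rule ccontr)
  assume d: "d \<notin> {1,4,5,6,9}"
  have "d \<noteq> 0" using assms adj_irrefl by (metis add_0_right mod_less)
  then have "clashing 0 chord_clashes ([(0,d)] @ decagon)"
    using d assms(2) by (intro check_chord) auto
  from decagon_clash0[OF decagon_at_turn[OF v, of i] this] show False
    using assms by (auto simp: add.commute)
qed

text \<open>
  An outside vertex adjacent to vertices at distance 3 lies on a 9-cycle; at distance 2 or 4 it
  closes a 4-cycle or a 6-cycle that a path on nine vertices can traverse in two ways.
\<close>

lemma hat_gap:
  assumes v: "decagon_at v" and x: "x \<notin> v ` {..<10}" and "d < 10" "i < 10"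
    and "adj (v i) x" "adj x (v ((i + d) mod 10))"
  shows "d \<in> {0,1,5,9}"
proof (rule ccontr)
  assume "d \<notin> {0,1,5,9}"
  then have "clashing 0 hat_clashes ([(0,10),(10,d)] @ decagon)"
    using assms by (intro check_hat)
  from decagon_clash1[OF decagon_at_turn[OF v, of i] turn_outside[OF x] this] show False
    using assms by (auto simp: add.commute)
qed

lemma bridge_gap:
  assumes v: "decagon_at v" and x: "x \<notin> v ` {..<10}" and y: "y \<notin> v ` {..<10}"
    and "d < 10" "i < 10" "adj (v i) x" "adj x y" "adj y (v ((i + d) mod 10))"
  shows "d = 0"
proof (rule ccontr)
  assume "d \<noteq> 0"
  then have cl: "clashing 0 bridge_clashes ([(0,10),(10,11),(11,d)] @ decagon)"
    using assms by (intro check_bridge)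
  have "x \<noteq> y" using assms adj_irrefl by blast
  from decagon_clash2[OF decagon_at_turn[OF v, of i] turn_outside[OF x] turn_outside[OF y] this cl]
  show False using assms by (auto simp: add.commute)
qed

lemma no_tail:
  assumes v: "decagon_at v" and "c \<in> v ` {..<10}"
    and x: "x \<notin> v ` {..<10}" and y: "y \<notin> v ` {..<10}" and z: "z \<notin> v ` {..<10}"
    and "adj c x" "adj x y" "adj y z" "x \<noteq> z"
  shows False
proof -
  obtain i where i: "i < 10" "c = v i" using assms(2) by auto
  have u: "decagon_at (turn i v)" using v by (rule decagon_at_turn)
  have "x \<noteq> y" "y \<noteq> z" using assms adj_irrefl by blast+
  then have inj: "inj_on ((turn i v)(10 := x, 11 := y, 12 := z)) {..<13}"
    using three_apexes[OF u turn_outside[OF x] turn_outside[OF y] turn_outside[OF z]] assms(9)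
    by blast
  show False
    by (rule decagon_clash[OF u inj _ _ _ check_tail]) (use assms i in auto)
qed

lemma gap_exists:
  fixes i j :: nat
  assumes "i < 10" "j < 10"
  obtains d where "d < 10" "j = (i + d) mod 10"
proof
  show "(j + 10 - i) mod 10 < 10" by simp
  have "i + (j + 10 - i) = j + 10" using assms by simp
  then show "j = (i + (j + 10 - i) mod 10) mod 10" using assms by (simp add: mod_simps)
qed

lemma decagon_vertices:
  assumes "decagon_at v"
  shows "v ` {..<10} \<subseteq> V" "card (v ` {..<10}) = 10"
proof -
  show "v ` {..<10} \<subseteq> V" using assms adj_in by (auto simp: decagon_at_def)
  show "card (v ` {..<10}) = 10" using assms by (simp add: decagon_at_def card_image)
qed

lemma second_neighbour:
  assumes "3 \<le> card V" "x \<in> V" "t \<in> V" "x \<noteq> t"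
  shows "\<exists>y. y \<noteq> t \<and> adj x y"
proof -
  have "{x} \<noteq> V - {t}"
  proof
    assume "{x} = V - {t}"
    then have "V \<subseteq> {x, t}" by auto
    then have "card V \<le> card {x, t}" by (rule card_mono[rotated]) simp
    then show False using assms(1,4) by simp
  qed
  then show ?thesis using crossing[of "{t}" "{x}"] assms by auto
qed

text \<open>
  Let \<open>T\<close> be the set of outside vertices with a neighbour on the decagon. A vertex two steps away from
  \<open>T\<close> would end a tail of length three, so connectedness leaves only the decagon, \<open>T\<close> and
  the neighbours of \<open>T\<close>. An outside vertex not in \<open>T\<close> has a second neighbour besides one in \<open>T\<close>, by
  2-connectedness, and that neighbour again ends a tail of length three.
\<close>

lemma outside_touches_decagon:
  assumes v: "decagon_at v" and x: "x \<in> V" "x \<notin> v ` {..<10}"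
  shows "\<exists>c\<in>v ` {..<10}. adj c x"
proof -
  let ?C = "v ` {..<10}"
  define T where "T = {t \<in> V - ?C. \<exists>c\<in>?C. adj c t}"
  define R where "R = ?C \<union> T \<union> {a \<in> V. \<exists>t\<in>T. adj t a}"
  have "R = V"
  proof (rule ccontr)
    assume "R \<noteq> V"
    moreover have "R \<subseteq> V" using decagon_vertices(1)[OF v] by (auto simp: R_def T_def)
    moreover have "v 0 \<in> R" by (simp add: R_def)
    ultimately obtain a b where ab: "a \<in> R" "b \<in> V - R" "adj a b"
      using crossing[of "{}" R] by (auto simp del: image_is_empty)
    then have b: "b \<notin> ?C" "b \<notin> T" "\<forall>t\<in>T. \<not> adj t b" by (auto simp: R_def)
    then have a: "a \<notin> ?C" "a \<notin> T" using ab by (auto simp: T_def)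
    then obtain t where t: "t \<in> T" "adj t a" using ab by (auto simp: R_def)
    then obtain c where "c \<in> ?C" "adj c t" "t \<notin> ?C" by (auto simp: T_def)
    moreover have "t \<noteq> b" using t b by auto
    ultimately show False using no_tail[OF v] a b t ab by blast
  qed
  have "x \<in> T"
  proof (rule ccontr)
    assume x': "x \<notin> T"
    then obtain t where t: "t \<in> T" "adj t x" using x \<open>R = V\<close> by (auto simp: R_def)
    then obtain c where c: "c \<in> ?C" "adj c t" "t \<notin> ?C" by (auto simp: T_def)
    have "3 \<le> card V" using decagon_vertices[OF v] finite_V card_mono[of V ?C] by simp
    moreover have "t \<in> V" "x \<noteq> t" using t x' by (auto simp: T_def)
    ultimately obtain z where z: "z \<noteq> t" "adj x z" using second_neighbour x by blast
    then have "z \<notin> ?C" using x x' adj_sym by (auto simp: T_def)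
    then show False using no_tail[OF v c(1,3) x(2) _ c(2) t(2) z(2)] z by blast
  qed
  then show ?thesis by (auto simp: T_def)
qed

text \<open>
  Both ends of an edge off the decagon touch the decagon. As bridges do not exist, they touch it in
  one common vertex \<open>c\<close> only, and tails of length three do not exist either, so \<open>c\<close> separates the
  edge from the rest of the decagon.
\<close>

lemma outside_independent:
  assumes v: "decagon_at v" and xy: "x \<notin> v ` {..<10}" "y \<notin> v ` {..<10}"
  shows "\<not> adj x y"
proof
  assume adj_xy: "adj x y"
  let ?C = "v ` {..<10}"
  have same_foot: "c = c'" if f: "c \<in> ?C" "c' \<in> ?C" "adj c x" "adj y c'" for c c'
  proof -
    obtain i j where ij: "i < 10" "j < 10" "c = v i" "c' = v j"
      using f(1,2) by blast
    obtain d where d: "d < 10" "j = (i + d) mod 10" using gap_exists[OF ij(1,2)] .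
    have "d = 0" using bridge_gap[OF v xy d(1) ij(1)] f adj_xy ij d by auto
    then show ?thesis using ij d by simp
  qed
  obtain c where c: "c \<in> ?C" "adj c x"
    using outside_touches_decagon[OF v _ xy(1)] adj_xy adj_in by blast
  obtain c' where c': "c' \<in> ?C" "adj c' y"
    using outside_touches_decagon[OF v _ xy(2)] adj_xy adj_in by blast
  have "c' = c" using same_foot[OF c(1) c'(1) c(2) adj_sym[OF c'(2)]] by simp
  have "card (?C - {c}) = 9" using c decagon_vertices(2)[OF v] by (simp add: card_Diff_singleton)
  then obtain e where "e \<in> ?C - {c}" by (metis card.empty ex_in_conv zero_neq_numeral)
  then have "e \<in> V - {c}" "e \<noteq> x" "e \<noteq> y" using decagon_vertices(1)[OF v] xy by auto
  then have "{x, y} \<noteq> V - {c}" by blast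
  moreover have "{x, y} \<subseteq> V - {c}" "{c} \<subseteq> V"
    using adj_xy adj_in c xy decagon_vertices(1)[OF v] by auto
  ultimately obtain a b where ab: "a \<in> {x, y}" "b \<in> V - {c} - {x, y}" "adj a b"
    using crossing[of "{c}" "{x, y}"] by auto
  have foot: "adj c x" "adj y c" "adj c y" "adj y x"
    using c c' \<open>c' = c\<close> adj_xy adj_sym by simp_all
  have b: "b \<noteq> c" "b \<noteq> x" "b \<noteq> y" using ab by simp_all
  consider "a = x" | "a = y" using ab by auto
  then show False
  proof cases
    case 1
    then show False
      using same_foot[of b c] no_tail[OF v c(1) xy(2,1) _ foot(3,4), of b] ab b c foot adj_sym
      by metis
  next
    case 2
    then show False
      using same_foot[of c b] no_tail[OF v c(1) xy _ foot(1) adj_xy, of b] ab b c foot by metis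
  qed
qed

lemma outside_feet:
  assumes v: "decagon_at v" and x: "x \<in> V" "x \<notin> v ` {..<10}"
  obtains i d where "i < 10" "d \<in> {1,5,9}" "adj (v i) x" "adj x (v ((i + d) mod 10))"
proof -
  obtain i where i: "i < 10" "adj (v i) x" using outside_touches_decagon[OF assms] by auto
  have "3 \<le> card V" using decagon_vertices[OF v] finite_V card_mono[of V "v ` {..<10}"] by simp
  then obtain y where y: "y \<noteq> v i" "adj x y"
    using second_neighbour[of x "v i"] x i adj_in by blast
  then obtain j where j: "j < 10" "y = v j" using outside_independent[OF v x(2)] by blast
  obtain d where d: "d < 10" "j = (i + d) mod 10" using gap_exists[OF i(1) j(1)] .
  have "d \<in> {0,1,5,9}" using hat_gap[OF v x(2) d(1) i] y j d by simp
  moreover have "d \<noteq> 0" using y j d i by (metis add_0_right mod_less)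
  ultimately show thesis using that[of i d] i y j d by simp
qed

section \<open>Sparse graphs around a decagon are not saturated\<close>

text \<open>
  The inverse labelling maps the graph into one of the three sparse labelled graphs; it is
  injective because at most one vertex, labelled 10, lies off the decagon. A path on nine vertices
  from \<open>v 0\<close> to \<open>v 3\<close> would map to a path between \<open>0\<close> and \<open>3\<close>. Only an inclusion
  of edge sets enters, so the lemma also serves for subgraphs, such as the bare decagon.
\<close>

lemma sparse_impossible:
  assumes v: "decagon_at v"
    and X: "X \<in> {[(0,4)], [(0,10),(10,1)], [(0,5),(0,10),(10,5)]}"
    and one: "\<And>x y. x \<in> V \<Longrightarrow> y \<in> V \<Longrightarrow> x \<notin> v ` {..<10} \<Longrightarrow> y \<notin> v ` {..<10} \<Longrightarrow> x = y"
    and chord: "\<And>i d. i < 10 \<Longrightarrow> d \<in> {4,5,6} \<Longrightarrow> adj (v i) (v ((i + d) mod 10))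
        \<Longrightarrow> linked X i ((i + d) mod 10)"
    and hat: "\<And>x i. x \<notin> v ` {..<10} \<Longrightarrow> i < 10 \<Longrightarrow> adj x (v i) \<Longrightarrow> linked X 10 i"
  shows False
proof -
  let ?L = "X @ decagon"
  have inj: "inj_on v {..<10}" using v by (simp add: decagon_at_def)
  define label where "label x = (if x \<in> v ` {..<10} then inv_into {..<10} v x else 10)" for x
  have label_v: "label (v i) = i" if "i < 10" for i
    using that inj by (simp add: label_def)
  have label_lt: "label x < 10 \<and> v (label x) = x" if "x \<in> v ` {..<10}" for x
    using that label_v by auto
  have "inj_on label V"
  proof (rule inj_onI)
    fix x y assume "x \<in> V" "y \<in> V" "label x = label y"
    then show "x = y" using one[of x y] label_lt[of x] label_lt[of y]
      by (metis label_def less_irrefl)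
  qed
  have linked_sym: "linked L i j \<longleftrightarrow> linked L j i" for L i j by (auto simp: linked_def)
  have ring: "linked ?L i ((i + 1) mod 10)" if "i < 10" for i
    using decagon_ring[OF that] by (auto simp: linked_def)
  have grow: "linked ?L i j" if "linked X i j" for i j using that by (auto simp: linked_def)
  have hat': "linked ?L (label x) (label y)"
    if "adj x y" "x \<notin> v ` {..<10}" for x y
  proof -
    have "y \<in> v ` {..<10}" using outside_independent[OF v] that by blast
    then obtain i where "i < 10" "y = v i" by auto
    then show ?thesis using that hat[of x i] grow label_v by (simp add: label_def[of x])
  qed
  have hom: "linked ?L (label x) (label y)" if "adj x y" for x y
  proof (cases "x \<in> v ` {..<10} \<and> y \<in> v ` {..<10}")
    case True
    then obtain i j where ij: "i < 10" "j < 10" "x = v i" "y = v j" by auto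
    obtain d where d: "d < 10" "j = (i + d) mod 10" using gap_exists[OF ij(1,2)] .
    have "d \<in> {1,4,5,6,9}" using chord_gap[OF v d(1) ij(1)] that ij d by simp
    moreover have "linked ?L i j" if "d \<in> {4,5,6}"
      using grow chord[OF ij(1) that] \<open>adj x y\<close> ij d by simp
    moreover have "linked ?L i j" if "d = 1" using ring[OF ij(1)] d that by simp
    moreover have "linked ?L i j" if "d = 9"
    proof -
      have "((i + 9) mod 10 + 1) mod 10 = (i + 10) mod 10" by (simp add: mod_simps)
      then have "(j + 1) mod 10 = i" using that ij(1) unfolding d(2) by simp
      then show ?thesis using ring[OF ij(2)] linked_sym by metis
    qed
    ultimately have "linked ?L i j" by blast
    then show ?thesis using ij label_v by simp
  next
    case False
    then show ?thesis using hat'[of x y] hat'[of y x] that adj_sym linked_sym by blast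
  qed
  have ends: "v 0 \<in> V" "v 3 \<in> V" "v 0 \<noteq> v 3"
    using decagon_vertices(1)[OF v] inj by (auto dest: inj_onD[of v _ 0 3])
  moreover have "\<not> adj (v 0) (v 3)"
    using hom[of "v 0" "v 3"] label_v check_sparse(2)[OF X] by auto
  ultimately obtain p where p: "length p = 9" "distinct p" "successively adj p"
      "hd p = v 0" "last p = v 3"
    using path_exists by blast
  have ne: "p \<noteq> []" using p by auto
  have "set p \<subseteq> V"
  proof
    fix x assume "x \<in> set p"
    then obtain k where k: "k < 9" "x = p ! k" using p by (metis in_set_conv_nth)
    have step: "adj (p ! m) (p ! Suc m)" if "m < 8" for m
      using p that by (auto simp: successively_conv_nth)
    show "x \<in> V"
    proof (cases k)
      case 0
      then show ?thesis using step[of 0] k adj_in by auto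
    next
      case (Suc m)
      then show ?thesis using step[of m] k adj_in by auto
    qed
  qed
  then have dist: "distinct (map label p)"
    using p \<open>inj_on label V\<close> by (simp add: distinct_map inj_on_subset)
  have hd0: "hd (map label p) = 0" using p ne label_v by (simp add: hd_map)
  have "route ?L 8 [0] 0 3"
  proof (rule route_complete[OF dist])
    show "successively (linked ?L) (map label p)"
      unfolding successively_map using p(3) by (rule successively_mono) (use hom in auto)
    show "last (map label p) = 3" using p ne label_v by (simp add: last_map)
    show "set (tl (map label p)) \<inter> set [0] = {}" using dist hd0 ne by (cases p) auto
  qed (use p hd0 in auto)
  then show False using check_sparse(1)[OF X] by simp
qed

section \<open>No two ears\<close>

text \<open>
  The kinds of ears are excluded one after the other; at each stage a single ear of the kind
  excludes all other ears, up to a hat and a chord on the same antipodal pair, and the graph is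
  sparse. The chord of gap 4 comes first because it clashes with every other ear.
\<close>

lemma no_gap4_chord:
  assumes v: "decagon_at v"
  shows "\<not> adj (v 0) (v 4)"
proof
  assume q: "adj (v 0) (v 4)"
  have no_outside: "x \<in> v ` {..<10}" if xV: "x \<in> V" for x
  proof (rule ccontr)
    assume x: "x \<notin> v ` {..<10}"
    obtain i d where id: "i < 10" "d \<in> {1,5,9}" "adj (v i) x" "adj x (v ((i + d) mod 10))"
      using outside_feet[OF v xV x] .
    show False
      by (rule decagon_clash1[OF v x check_gap4_hat[OF id(1,2)]])
        (use id q in auto)
  qed
  show False
  proof (rule sparse_impossible[OF v, where X = "[(0,4)]"])
    fix i d :: nat assume id: "i < 10" "d \<in> {4,5,6}" "adj (v i) (v ((i + d) mod 10))"
    have "(i, (i + d) mod 10) \<in> {(0,4),(4,0)}"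
    proof (rule ccontr)
      assume "(i, (i + d) mod 10) \<notin> {(0,4),(4,0)}"
      from check_gap4_chord[OF id(1,2) this] show False
        by (rule decagon_clash0[OF v]) (use id q in auto)
    qed
    then show "linked [(0,4)] i ((i + d) mod 10)" by (auto simp: linked_def)
  qed (use no_outside adj_in in auto)
qed

lemma chord_gap_diameter:
  assumes v: "decagon_at v" and "d < 10" "i < 10" "adj (v i) (v ((i + d) mod 10))"
  shows "d \<in> {1,5,9}"
proof -
  have "d \<noteq> 4" using no_gap4_chord[OF decagon_at_turn[OF v, of i]] assms
    by (auto simp: add.commute)
  \<comment> \<open>A chord of gap 6 has gap 4 when read from its other end.\<close>
  moreover have "d \<noteq> 6"
  proof
    assume "d = 6"
    moreover have "(4 + (i + 6)) mod 10 = i" using assms by simp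
    ultimately show False
      using no_gap4_chord[OF decagon_at_turn[OF v, of "i + 6"]] assms adj_sym by auto
  qed
  ultimately show ?thesis using chord_gap[OF assms] by auto
qed

lemma no_short_hat:
  assumes v: "decagon_at v" and x: "x \<notin> v ` {..<10}"
  shows "\<not> (adj (v 0) x \<and> adj x (v 1))"
proof
  assume h: "adj (v 0) x \<and> adj x (v 1)"
  have only: "y = x" if y: "y \<in> V" "y \<notin> v ` {..<10}" for y
  proof (rule ccontr)
    assume "y \<noteq> x"
    obtain i d where id: "i < 10" "d \<in> {1,5,9}" "adj (v i) y" "adj y (v ((i + d) mod 10))"
      using outside_feet[OF v y] .
    show False
      by (rule decagon_clash2[OF v x y(2) _ check_short_hat_hat[OF id(1,2)]])
        (use id h \<open>y \<noteq> x\<close> in auto)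
  qed
  show False
  proof (rule sparse_impossible[OF v, where X = "[(0,10),(10,1)]"])
    fix i d :: nat assume id: "i < 10" "d \<in> {4,5,6}" "adj (v i) (v ((i + d) mod 10))"
    have "d = 5" using chord_gap_diameter[OF v _ id(1,3)] id(2) by auto
    then have False
      using decagon_clash1[OF v x check_short_hat_chord[OF id(1)]] id h
      by auto
    then show "linked [(0,10),(10,1)] i ((i + d) mod 10)" ..
  next
    fix y i assume y: "y \<notin> v ` {..<10}" "i < 10" "adj y (v i)"
    then have "y = x" using only adj_in by blast
    obtain d where d: "d < 10" "i = (0 + d) mod 10" using gap_exists[of 0 i] y by auto
    obtain e where e: "e < 10" "i = (1 + e) mod 10" using gap_exists[of 1 i] y by auto
    have "d \<in> {0,1,5,9}" using hat_gap[OF v x d(1), of 0] h y d \<open>y = x\<close> by auto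
    moreover have "e \<in> {0,1,5,9}" using hat_gap[OF v x e(1), of 1] h y e \<open>y = x\<close> adj_sym by auto
    ultimately have "i = 0 \<or> i = 1" using d e by auto
    then show "linked [(0,10),(10,1)] 10 i" by (auto simp: linked_def)
  next
    show "y = z" if "y \<in> V" "z \<in> V" "y \<notin> v ` {..<10}" "z \<notin> v ` {..<10}" for y z
      using only that by metis
  qed simp
qed

text \<open>
  The gaps 1 and 9 describe a hat over an edge of the decagon, read from either end.
\<close>

lemma outside_feet_antipodal:
  assumes v: "decagon_at v" and x: "x \<in> V" "x \<notin> v ` {..<10}"
  obtains i where "i < 10" "adj (v i) x" "adj x (v ((i + 5) mod 10))"
proof -
  obtain i d where id: "i < 10" "d \<in> {1,5,9}" "adj (v i) x" "adj x (v ((i + d) mod 10))"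
    using outside_feet[OF assms] .
  have no: "\<not> (adj (v (k mod 10)) x \<and> adj x (v ((k + 1) mod 10)))" for k
    using no_short_hat[OF decagon_at_turn[OF v, of k], of x] x(2) unfolding turn_image
    by (simp add: add.commute)
  have "d \<noteq> 1" using no[of i] id by auto
  moreover have "d \<noteq> 9"
  proof
    assume "d = 9"
    moreover have "(i + 9 + 1) mod 10 = i" using id by simp
    ultimately show False using no[of "i + 9"] id adj_sym by auto
  qed
  ultimately show thesis using that id by auto
qed

text \<open>
  Here the chord below the hat may or may not be an edge; the sparse graph contains both.
\<close>

lemma no_long_hat:
  assumes v: "decagon_at v" and x: "x \<notin> v ` {..<10}"
  shows "\<not> (adj (v 0) x \<and> adj x (v 5))"
proof
  assume h: "adj (v 0) x \<and> adj x (v 5)"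
  have only: "y = x" if y: "y \<in> V" "y \<notin> v ` {..<10}" for y
  proof (rule ccontr)
    assume "y \<noteq> x"
    obtain i where i: "i < 10" "adj (v i) y" "adj y (v ((i + 5) mod 10))"
      using outside_feet_antipodal[OF v y] .
    show False
      by (rule decagon_clash2[OF v x y(2) _ check_long_hat_hat[OF i(1)]])
        (use i h \<open>y \<noteq> x\<close> in auto)
  qed
  show False
  proof (rule sparse_impossible[OF v, where X = "[(0,5),(0,10),(10,5)]"])
    fix i d :: nat assume id: "i < 10" "d \<in> {4,5,6}" "adj (v i) (v ((i + d) mod 10))"
    have "d = 5" using chord_gap_diameter[OF v _ id(1,3)] id(2) by auto
    have "i = 0 \<or> i = 5"
    proof (rule ccontr)
      assume "\<not> (i = 0 \<or> i = 5)"
      then show False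
        using decagon_clash1[OF v x check_long_hat_chord[OF id(1)]]
          id h \<open>d = 5\<close> by auto
    qed
    then show "linked [(0,5),(0,10),(10,5)] i ((i + d) mod 10)"
      using \<open>d = 5\<close> by (auto simp: linked_def)
  next
    fix y i assume y: "y \<notin> v ` {..<10}" "i < 10" "adj y (v i)"
    then have "y = x" using only adj_in by blast
    obtain d where d: "d < 10" "i = (0 + d) mod 10" using gap_exists[of 0 i] y by auto
    obtain e where e: "e < 10" "i = (5 + e) mod 10" using gap_exists[of 5 i] y by auto
    have "d \<in> {0,1,5,9}" using hat_gap[OF v x d(1), of 0] h y d \<open>y = x\<close> by auto
    moreover have "e \<in> {0,1,5,9}" using hat_gap[OF v x e(1), of 5] h y e \<open>y = x\<close> adj_sym by auto
    ultimately have "i = 0 \<or> i = 5" using d e by auto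
    then show "linked [(0,5),(0,10),(10,5)] 10 i" by (auto simp: linked_def)
  next
    show "y = z" if "y \<in> V" "z \<in> V" "y \<notin> v ` {..<10}" "z \<notin> v ` {..<10}" for y z
      using only that by metis
  qed simp
qed

lemma no_outside:
  assumes v: "decagon_at v" and x: "x \<in> V"
  shows "x \<in> v ` {..<10}"
proof (rule ccontr)
  assume x': "x \<notin> v ` {..<10}"
  obtain i where i: "i < 10" "adj (v i) x" "adj x (v ((i + 5) mod 10))"
    using outside_feet_antipodal[OF v x x'] .
  then show False
    using no_long_hat[OF decagon_at_turn[OF v, of i], of x] x' unfolding turn_image
    by (simp add: add.commute)
qed

lemma no_diameter:
  assumes v: "decagon_at v"
  shows "\<not> adj (v 0) (v 5)"
proof
  assume q: "adj (v 0) (v 5)"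
  show False
  proof (rule sparse_impossible[OF v, where X = "[(0,5),(0,10),(10,5)]"])
    fix i d :: nat assume id: "i < 10" "d \<in> {4,5,6}" "adj (v i) (v ((i + d) mod 10))"
    have "d = 5" using chord_gap_diameter[OF v _ id(1,3)] id(2) by auto
    have "i = 0 \<or> i = 5"
    proof (rule ccontr)
      assume "\<not> (i = 0 \<or> i = 5)"
      then show False
        using decagon_clash0[OF v check_diameter_chord[OF id(1)]] id q \<open>d = 5\<close> by auto
    qed
    then show "linked [(0,5),(0,10),(10,5)] i ((i + d) mod 10)"
      using \<open>d = 5\<close> by (auto simp: linked_def)
  qed (use no_outside[OF v] adj_in in auto)
qed

lemma no_decagon: "\<not> decagon_at v"
proof
  assume v: "decagon_at v"
  show False
  proof (rule sparse_impossible[OF v, where X = "[(0,4)]"])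
    fix i d :: nat assume id: "i < 10" "d \<in> {4,5,6}" "adj (v i) (v ((i + d) mod 10))"
    then have "d = 5" using chord_gap_diameter[OF v _ id(1,3)] by auto
    then have False using no_diameter[OF decagon_at_turn[OF v, of i]] id by (simp add: add.commute)
    then show "linked [(0,4)] i ((i + d) mod 10)" ..
  qed (use no_outside[OF v] adj_in in auto)
qed

end

section \<open>From uniquely saturated graphs to paths on nine vertices\<close>

lemma cycle_edges_subset_iff:
  assumes "vs \<noteq> []"
  shows "cycle_edges vs \<subseteq> E \<longleftrightarrow>
    successively (\<lambda>x y. {x, y} \<in> E) vs \<and> {last vs, hd vs} \<in> E"
proof -
  obtain n where n: "length vs = Suc n" using assms by (cases vs) auto
  have "cycle_edges vs \<subseteq> E \<longleftrightarrow> (\<forall>i<Suc n. {vs ! i, vs ! (Suc i mod Suc n)} \<in> E)"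
    by (auto simp: cycle_edges_def n)
  also have "\<dots> \<longleftrightarrow> {vs ! n, vs ! 0} \<in> E \<and> (\<forall>i<n. {vs ! i, vs ! Suc i} \<in> E)"
  proof -
    have "Suc i mod Suc n = Suc i" if "i < n" for i using that by (intro mod_less) simp
    then show ?thesis unfolding All_less_Suc by simp
  qed
  also have "\<dots> \<longleftrightarrow> successively (\<lambda>x y. {x, y} \<in> E) vs \<and> {last vs, hd vs} \<in> E"
    unfolding successively_conv_nth n last_conv_nth[OF assms] hd_conv_nth[OF assms] by auto
  finally show ?thesis .
qed

text \<open>
  A cycle is a set of edges here, so equality of the two cycles that close two paths has to be
  turned into equality of the paths. Starting from the common first vertex, each further vertex of
  \<open>p\<close> is a neighbour on the cycle of the one before, and by distinctness not the one just left; the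
  common last vertex fixes the direction of the first step.
\<close>

lemma cycle_edges_determine_path:
  assumes "distinct p" "distinct q" "length p = n" "length q = n" "3 \<le> n"
    and "hd p = hd q" "last p = last q" "cycle_edges p = cycle_edges q"
  shows "p = q"
proof -
  have ne: "p \<noteq> []" "q \<noteq> []" using assms(3,4,5) by auto
  then have first: "p ! 0 = q ! 0" and final: "p ! (n - 1) = q ! (n - 1)"
    using assms by (simp_all add: hd_conv_nth last_conv_nth)
  have eqs: "\<forall>i\<le>k. p ! i = q ! i" if "k < n" for k
    using that
  proof (induction k)
    case 0
    then show ?case using first by simp
  next
    case (Suc k)
    then have IH: "p ! i = q ! i" if "i \<le> k" for i using that by simp
    have "Suc k mod length p = Suc k" using Suc.prems assms(3) by simp
    then have "{p ! k, p ! Suc k} \<in> cycle_edges p"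
      unfolding cycle_edges_def using Suc.prems assms(3) by force
    then have "{p ! k, p ! Suc k} \<in> cycle_edges q" by (simp add: assms(8))
    then obtain j where j: "j < n" "{p ! k, p ! Suc k} = {q ! j, q ! (Suc j mod n)}"
      unfolding cycle_edges_def using assms(4) by auto
    then consider "q ! k = q ! j" "p ! Suc k = q ! (Suc j mod n)"
      | "q ! k = q ! (Suc j mod n)" "p ! Suc k = q ! j"
      using IH[of k] by (auto simp: doubleton_eq_iff)
    then have "p ! Suc k = q ! Suc k"
    proof cases
      case 1
      then have "k = j" using j Suc.prems assms(2,4) by (simp add: nth_eq_iff_index_eq)
      then show ?thesis using 1 Suc.prems by simp
    next
      case 2
      have "Suc j mod n < n" using Suc.prems by simp
      then have k: "k = Suc j mod n" using 2 Suc.prems assms(2,4) by (simp add: nth_eq_iff_index_eq)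
      show ?thesis
      proof (cases "Suc j = n")
        case True
        then have "p ! Suc k = p ! (n - 1)" using 2 final by auto
        then have "Suc k = n - 1" using Suc.prems assms(1,3) by (simp add: nth_eq_iff_index_eq)
        then show ?thesis using True k assms(5) by simp
      next
        case False
        then have "k = Suc j" using j k by simp
        then have "p ! Suc k = p ! j" using 2 IH by simp
        then have "Suc k = j" using Suc.prems j(1) assms(1,3) by (simp add: nth_eq_iff_index_eq)
        then show ?thesis using \<open>k = Suc j\<close> by simp
      qed
    qed
    then show ?case using IH by (auto simp: le_Suc_eq)
  qed
  then have "p ! i = q ! i" if "i < n" for i using that by blast
  then show ?thesis using assms(3,4) by (simp add: list_eq_iff_nth_eq)
qed

text \<open>
  Rotating the cycle until it begins just after the edge \<open>{x, y}\<close> moves this edge to the closing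
  step; the remaining steps form the path, which has to be reversed if it runs from \<open>y\<close> to \<open>x\<close>.
\<close>

lemma path_of_cycle_through_edge:
  assumes "distinct vs" "length vs = n" "3 \<le> n" "cycle_edges vs \<subseteq> insert {x, y} E" "{x, y} \<notin> E"
    and "{x, y} \<in> cycle_edges vs" "x \<noteq> y"
  shows "\<exists>p. length p = n \<and> distinct p \<and> successively (\<lambda>a b. {a, b} \<in> E) p \<and> hd p = x \<and> last p = y"
proof -
  obtain i where i: "i < n" "{x, y} = {vs ! i, vs ! (Suc i mod n)}"
    using assms(2,6) by (auto simp: cycle_edges_def)
  define p where "p = rotate (Suc i) vs"
  have p: "length p = n" "distinct p" "p \<noteq> []" using assms(1,2,3) by (auto simp: p_def)
  have nth: "p ! m = vs ! ((Suc i + m) mod n)" if "m < n" for m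
    using nth_rotate[of m vs "Suc i"] that assms(2) by (simp add: p_def)
  have "p ! (n - 1) = vs ! ((i + n) mod n)" using nth[of "n - 1"] assms(3) by simp
  then have ends: "{x, y} = {last p, hd p}"
    using i p nth[of 0] assms(3) by (simp add: last_conv_nth hd_conv_nth)
  have "{p ! m, p ! Suc m} \<in> insert {x, y} E" if "Suc m < n" for m
  proof -
    define k where "k = (Suc i + m) mod n"
    have "Suc k mod n = (Suc i + Suc m) mod n" by (simp add: k_def mod_Suc_eq)
    then have "{p ! m, p ! Suc m} = {vs ! k, vs ! (Suc k mod n)}"
      using nth[of m] nth[of "Suc m"] that by (simp add: k_def)
    moreover have "k < n" using assms(3) by (simp add: k_def)
    ultimately have "{p ! m, p ! Suc m} \<in> cycle_edges vs"
      using assms(2) by (auto simp: cycle_edges_def)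
    then show ?thesis using assms(4) by blast
  qed
  moreover have "{p ! m, p ! Suc m} \<noteq> {x, y}" if "Suc m < n" for m
  proof
    assume "{p ! m, p ! Suc m} = {x, y}"
    then have "{p ! m, p ! Suc m} = {p ! (n - 1), p ! 0}"
      using ends p by (simp add: last_conv_nth hd_conv_nth)
    then have "{m, Suc m} = {n - 1, 0}"
      using p that by (auto simp: doubleton_eq_iff nth_eq_iff_index_eq)
    then show False using that assms(3) by (auto simp: doubleton_eq_iff)
  qed
  ultimately have suc: "successively (\<lambda>a b. {a, b} \<in> E) p"
    using p(1) by (auto simp: successively_conv_nth)
  then have rev: "successively (\<lambda>a b. {a, b} \<in> E) (rev p)"
    by (simp add: successively_rev insert_commute)
  consider "hd p = x" "last p = y" | "last p = x" "hd p = y"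
    using ends by (auto simp: doubleton_eq_iff)
  then show ?thesis
  proof cases
    case 1
    then show ?thesis using p suc by blast
  next
    case 2
    then have "length (rev p) = n \<and> distinct (rev p) \<and>
        successively (\<lambda>a b. {a, b} \<in> E) (rev p) \<and> hd (rev p) = x \<and> last (rev p) = y"
      using p rev by (simp add: hd_rev last_rev)
    then show ?thesis by blast
  qed
qed

lemma connected_graph_crossing:
  assumes "connected_graph W F" "S \<subseteq> W" "S \<noteq> {}" "S \<noteq> W" "\<Union> F \<subseteq> W"
  shows "\<exists>x\<in>S. \<exists>y\<in>W - S. {x, y} \<in> F"
proof -
  obtain s t where st: "s \<in> S" "t \<in> W" "t \<notin> S" using assms(2,3,4) by blast
  have path: "(s, t) \<in> {(x, y). {x, y} \<in> F}\<^sup>*"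
    using assms(1,2) st by (auto simp: connected_graph_def)
  have "t \<in> S \<or> (\<exists>x\<in>S. \<exists>y\<in>W - S. {x, y} \<in> F)"
    using path
  proof (induction rule: rtrancl_induct)
    case base
    then show ?case using st by simp
  next
    case (step y z)
    then have "z \<in> W" using assms(5) by blast
    with step show ?case by blast
  qed
  then show ?thesis using st by blast
qed

lemma path_saturated_of_uniquely_saturated:
  assumes graph: "fin_simple_graph V E" and conn: "k_connected 2 V E"
    and sat: "uniquely_cycle_saturated 9 V E" and no12: "\<not> has_cycle 12 E"
  shows "path_saturated V (\<lambda>x y. {x, y} \<in> E)"
proof
  let ?adj = "\<lambda>x y. {x, y} \<in> E"
  have edges: "e \<subseteq> V" "card e = 2" if "e \<in> E" for e
    using graph that by (auto simp: fin_simple_graph_def all_edges_def)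
  have no9: "\<not> has_cycle 9 E" using sat by (simp add: uniquely_cycle_saturated_def)
  show "finite V" using graph by (simp add: fin_simple_graph_def)
  show in_V: "x \<in> V \<and> y \<in> V" if "?adj x y" for x y using edges(1)[OF that] by simp
  show "?adj y x" if "?adj x y" for x y using that by (simp add: insert_commute)
  show "\<not> ?adj x x" for x using edges(2)[of "{x}"] by auto
  show no_cycle: "\<not> ?adj (last p) (hd p)"
    if "length p = 9 \<or> length p = 12" "distinct p" "successively ?adj p" for p
  proof
    assume "?adj (last p) (hd p)"
    then have "cycle_edges p \<subseteq> E" using that by (subst cycle_edges_subset_iff) auto
    then have "has_cycle 9 E \<or> has_cycle 12 E"
      using that unfolding has_cycle_def is_cycle_def by auto
    then show False using no9 no12 by blast
  qed
  show "p = q"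
    if pq: "length p = 9" "length q = 9" "distinct p" "distinct q" "successively ?adj p"
      "successively ?adj q" "hd p = hd q" "last p = last q" for p q
  proof -
    have ne: "p \<noteq> []" "q \<noteq> []" using pq by auto
    let ?e = "{last p, hd p}"
    have "?e \<notin> E" using no_cycle[of p] pq by blast
    moreover have "?e \<in> all_edges V"
    proof -
      \<comment> \<open>The end vertices lie in \<open>V\<close> because they carry the first and the last edge.\<close>
      have "p ! 0 \<noteq> p ! 8" using pq(1,3) by (simp add: nth_eq_iff_index_eq)
      moreover have "?adj (p ! i) (p ! Suc i)" if "i < 8" for i
        using pq(1,5) that by (auto simp: successively_conv_nth)
      from this[of 0] this[of 7] have "?adj (p ! 0) (p ! 1)" "?adj (p ! 7) (p ! 8)" by simp_all
      ultimately show ?thesis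
        using pq(1) ne in_V by (auto simp: all_edges_def last_conv_nth hd_conv_nth)
    qed
    ultimately have "\<exists>!C. is_cycle 9 (insert ?e E) C"
      using sat by (simp add: uniquely_cycle_saturated_def)
    moreover have "is_cycle 9 (insert ?e E) (cycle_edges r)"
      if "length r = 9" "distinct r" "successively ?adj r" "last r = last p" "hd r = hd p" for r
    proof -
      have "successively (\<lambda>x y. {x, y} \<in> insert ?e E) r"
        using that(3) by (rule successively_mono) auto
      then have "cycle_edges r \<subseteq> insert ?e E"
        using that by (subst cycle_edges_subset_iff) auto
      then show ?thesis using that by (auto simp: is_cycle_def)
    qed
    ultimately have "cycle_edges p = cycle_edges q" using pq by metis
    then show "p = q" using cycle_edges_determine_path[of p q 9] pq by simp
  qed
  show "\<exists>p. length p = 9 \<and> distinct p \<and> successively ?adj p \<and> hd p = x \<and> last p = y"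
    if xy: "x \<in> V" "y \<in> V" "x \<noteq> y" "\<not> ?adj x y" for x y
  proof -
    have "{x, y} \<in> all_edges V - E" using xy by (auto simp: all_edges_def)
    then obtain C where C: "is_cycle 9 (insert {x, y} E) C"
      using sat unfolding uniquely_cycle_saturated_def by blast
    then obtain vs where vs: "distinct vs" "length vs = 9" "C = cycle_edges vs"
        "cycle_edges vs \<subseteq> insert {x, y} E"
      by (auto simp: is_cycle_def)
    have "{x, y} \<in> cycle_edges vs"
    proof (rule ccontr)
      assume "{x, y} \<notin> cycle_edges vs"
      then have "is_cycle 9 E C" using C vs(3) by (auto simp: is_cycle_def)
      then show False using no9 by (auto simp: has_cycle_def)
    qed
    then show ?thesis using path_of_cycle_through_edge[OF vs(1,2) _ vs(4)] xy by simp
  qed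
  show "\<exists>x\<in>S. \<exists>y\<in>V - X - S. ?adj x y"
    if S: "X \<subseteq> V" "card X < 2" "S \<subseteq> V - X" "S \<noteq> {}" "S \<noteq> V - X" for X S
  proof -
    have "connected_graph (V - X) {e \<in> E. e \<inter> X = {}}"
      using conn S(1,2) by (simp add: k_connected_def)
    moreover have "\<Union> {e \<in> E. e \<inter> X = {}} \<subseteq> V - X" using edges(1) by blast
    ultimately show ?thesis using connected_graph_crossing[of "V - X" _ S] S by blast
  qed
qed

theorem proposition4p10:
  fixes V :: "'a set" and E :: "'a set set"
  assumes "fin_simple_graph V E"
    and "k_connected 2 V E"
    and "card V \<ge> 9"
    and "uniquely_cycle_saturated 9 V E"
  shows "\<not> longest_even_cycle_at_most 12 E 10 \<and>
         \<not> (has_cycle 10 E \<and> \<not> has_cycle 12 E)"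
proof -
  have main: "\<not> (has_cycle 10 E \<and> \<not> has_cycle 12 E)"
  proof
    assume c: "has_cycle 10 E \<and> \<not> has_cycle 12 E"
    interpret path_saturated V "\<lambda>x y. {x, y} \<in> E"
      using assms(1,2,4) c by (intro path_saturated_of_uniquely_saturated) auto
    obtain vs where vs: "distinct vs" "length vs = 10" "cycle_edges vs \<subseteq> E"
      using c by (auto simp: has_cycle_def is_cycle_def)
    have "{vs ! i, vs ! ((i + 1) mod 10)} \<in> E" if "i < 10" for i
      using vs(2,3) that by (auto simp: cycle_edges_def)
    then have "decagon_at (\<lambda>i. vs ! i)"
      using vs(1,2) by (auto simp: decagon_at_def inj_on_def nth_eq_iff_index_eq)
    then show False using no_decagon by blast
  qed
  have "has_cycle 10 E \<and> \<not> has_cycle 12 E" if longest: "longest_even_cycle_at_most 12 E 10"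
  proof -
    have "even (12::nat) \<and> (12::nat) \<le> 12 \<and> has_cycle 12 E \<longrightarrow> (12::nat) \<le> 10"
      using longest unfolding longest_even_cycle_at_most_def by blast
    then show ?thesis using longest by (simp add: longest_even_cycle_at_most_def)
  qed
  with main show ?thesis by blast
qed

end
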